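(* Let $q$ be a prime power and $e,d$ positive integers with $e>d$ and $q>d(2e-d+1)/2$. Let $g\in\mathbb{F}_q[T]$ be monic of degree $e$. With $f$ uniformly distributed over the monic polynomials of degree $d$ in $\mathbb{F}_q[T]$, the expected costs of the Euclidean algorithm on $(g,f)$ satisfy $$\left|\frac{E[t^{\sf div}_g]}{d+1}-1\right|\le\frac{de}{q},\qquad \left|\frac{E[t^{\div}_g]}{e+d+1}-1\right|\le\frac{de}{q},\qquad \left|\frac{E[t^{-,\times}_g]}{de}-1\right|\le\frac{de}{q}.$$
   Context: Euclidean algorithm on $(g,f)$: set $r_{-1}=g$, $r_0=f$, and for $i\ge1$, while $r_{i-1}\neq0$, let $r_i$ be the remainder of the division of $r_{i-2}$ by $r_{i-1}$; it stops when a zero remainder is obtained, so it performs divisions $r_{i-2}=q_i r_{i-1}+r_i$, the last one having remainder $0$. Cost model: a polynomial division of a polynomial of degree $m$ by one of degree $n\le m$ (synthetic division) is counted as using $m-n+1$ divisions in $\mathbb{F}_q$ and $n(m-n+1)$ operations of type subtraction/multiplication in $\mathbb{F}_q$. Define $t^{\sf div}_g(f)$ = number of polynomial divisions performed (including the last one), $t^{\div}_g(f)$ = total number of divisions in $\mathbb{F}_q$ over all these polynomial divisions, and $t^{-,\times}_g(f)$ = total number of subtraction/multiplication operations (i.e. $\sum n(m-n+1)$ over all polynomial divisions). $E$ denotes expectation. *)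

theory Defs
  imports "HOL-Probability.Probability" "HOL-Computational_Algebra.Computational_Algebra"
begin

text \<open>
  The list of polynomial divisions performed by the Euclidean algorithm, each recorded as
  (dividend, divisor): \<open>(r\<^bsub>-1\<^esub>, r\<^sub>0), (r\<^sub>0, r\<^sub>1), \<dots>\<close>, up to and including the division with
  remainder \<open>0\<close>.
\<close>

function euclid_divisions :: "'a::field poly \<Rightarrow> 'a poly \<Rightarrow> ('a poly \<times> 'a poly) list" where
  "euclid_divisions a b = (if b = 0 then [] else (a, b) # euclid_divisions b (a mod b))"
  by pat_completeness auto
termination
  by (relation "Wellfounded.measure (\<lambda>(a, b). euclidean_size b)") (auto simp: mod_size_less)

declare euclid_divisions.simps [simp del]

text \<open>
  The subtraction of degrees never truncates in the intended use: the first dividend has larger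
  degree than the first divisor, and afterwards every divisor is a remainder modulo the dividend.
\<close>

definition div_cost_div :: "'a::field poly \<Rightarrow> 'a poly \<Rightarrow> nat" where
  "div_cost_div a b = degree a - degree b + 1"

definition div_cost_submult :: "'a::field poly \<Rightarrow> 'a poly \<Rightarrow> nat" where
  "div_cost_submult a b = degree b * (degree a - degree b + 1)"

definition t_poly_div :: "'a::field poly \<Rightarrow> 'a poly \<Rightarrow> nat" where
  "t_poly_div g f = length (euclid_divisions g f)"

definition t_field_div :: "'a::field poly \<Rightarrow> 'a poly \<Rightarrow> nat" where
  "t_field_div g f = (\<Sum>(a, b)\<leftarrow>euclid_divisions g f. div_cost_div a b)"

definition t_submult :: "'a::field poly \<Rightarrow> 'a poly \<Rightarrow> nat" where
  "t_submult g f = (\<Sum>(a, b)\<leftarrow>euclid_divisions g f. div_cost_submult a b)"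

definition monic_polys :: "nat \<Rightarrow> 'a::field poly set" where
  "monic_polys d = {f. lead_coeff f = 1 \<and> degree f = d}"

lemma monic_polys_nonempty: "monic_polys d \<noteq> ({} :: 'a::field poly set)"
proof -
  have "monom 1 d \<in> (monic_polys d :: 'a poly set)"
    by (simp add: monic_polys_def degree_monom_eq)
  then show ?thesis by blast
qed

lemma finite_monic_polys: "finite (monic_polys d :: 'a::{finite,field} poly set)"
proof (rule finite_subset)
  show "monic_polys d \<subseteq> Poly ` {xs :: 'a list. set xs \<subseteq> UNIV \<and> length xs \<le> Suc d}"
  proof
    fix f :: "'a poly" assume "f \<in> monic_polys d"
    then have "length (coeffs f) \<le> Suc d"
      by (cases "f = 0") (auto simp: monic_polys_def length_coeffs_degree)
    then show "f \<in> Poly ` {xs :: 'a list. set xs \<subseteq> UNIV \<and> length xs \<le> Suc d}"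
      by (intro image_eqI[of _ _ "coeffs f"]) auto
  qed
qed (intro finite_imageI finite_lists_length_le finite)

end

theory Submission
  imports Defs
begin

text \<open>
  Each of the three costs is maximal, with values \<open>d + 1\<close>, \<open>e + d + 1\<close> and \<open>d e\<close>, when the
  remainders have degrees \<open>d, d - 1, \<dots>, 0\<close>, so it suffices to bound the probability that some
  degree \<open>k < d\<close> is skipped. By the cofactor identity of the extended Euclidean algorithm, degree
  \<open>k\<close> is skipped only if \<open>u f mod g\<close> has degree less than \<open>k\<close> for some \<open>u \<noteq> 0\<close> of degree less
  than \<open>e - k\<close>. Replacing \<open>f\<close> by \<open>f + t x\<^sup>k\<close> adds \<open>t\<close> times the identity to the linear map sending
  \<open>u\<close> to the coefficients of \<open>u f mod g\<close> from \<open>k\<close> onwards. Hence on each line \<open>f + t x\<^sup>k\<close> the bad \<open>t\<close>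
  are negated eigenvalues of an operator on a space of dimension \<open>e - k\<close>, and the probability
  is at most \<open>\<Sum>k<d. (e - k) / q \<le> d e / q\<close>.
\<close>

section \<open>Eigenvectors and eigenvalues on spaces of polynomials\<close>

text \<open>By induction on \<open>B\<close>: if \<open>b\<close> were a combination of the others,
  applying \<open>A\<close> and subtracting \<open>l b\<close> times the relation would give one
  with coefficients \<open>c v * (l v - l b)\<close>. So all \<open>c v\<close> vanish and
  \<open>b = 0\<close>.\<close>

lemma (in vector_space) independent_eigenvectors:
  assumes "finite B" and "0 \<notin> B" and "inj_on l B"
    and A: "Vector_Spaces.linear scale scale A"
    and "\<And>b. b \<in> B \<Longrightarrow> A b = scale (l b) b"
  shows "independent B"
  using assms(1-3,5)
proof (induction B rule: finite_induct)
  case empty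
  show ?case by (rule independent_empty)
next
  case (insert b B)
  interpret A: Vector_Spaces.linear scale scale A by (rule A)
  have ind: "independent B"
    using insert.prems by (intro insert.IH) (auto simp: inj_on_def)
  have "b \<notin> span B"
  proof
    assume "b \<in> span B"
    then obtain c where c: "b = (\<Sum>v\<in>B. scale (c v) v)"
      using insert.hyps(1) by (auto simp: span_finite)
    have "(\<Sum>v\<in>B. scale (c v) (scale (l v) v)) = (\<Sum>v\<in>B. A (scale (c v) v))"
      using insert.prems(3) by (intro sum.cong) (auto simp: A.scale)
    also have "\<dots> = A b"
      by (subst c) (simp add: A.sum)
    also have "\<dots> = scale (l b) (\<Sum>v\<in>B. scale (c v) v)"
      using insert.prems(3)[of b] c by simp
    also have "\<dots> = (\<Sum>v\<in>B. scale (l b) (scale (c v) v))"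
      by (simp only: scale_sum_right)
    finally have "(\<Sum>v\<in>B. scale (c v * (l v - l b)) v) = 0"
      by (simp add: algebra_simps sum_subtractf)
    then have "c v * (l v - l b) = 0" if "v \<in> B" for v
      by (rule independentD[OF ind insert.hyps(1) subset_refl _ that])
    moreover have "l v - l b \<noteq> 0" if "v \<in> B" for v
      using insert.prems(2) insert.hyps(2) that by (auto simp: inj_on_def)
    ultimately have "c v = 0" if "v \<in> B" for v
      using that by (metis mult_eq_0_iff)
    then have "b = 0" using c by simp
    then show False using insert.prems(1) by simp
  qed
  with ind show ?case by (rule independent_insertI[rotated])
qed

interpretation poly_vs: vector_space "smult :: 'a::field \<Rightarrow> 'a poly \<Rightarrow> 'a poly"
  by unfold_locales (simp_all add: smult_add_right smult_add_left)

lemma poly_in_span_monoms: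
  fixes u :: "'a::field poly"
  assumes "u \<noteq> 0 \<Longrightarrow> degree u < n"
  shows "u \<in> poly_vs.span (monom 1 ` {..<n})"
proof -
  have "u = (\<Sum>i\<le>degree u. smult (coeff u i) (monom 1 i))"
    by (simp add: smult_monom poly_as_sum_of_monoms)
  also have "\<dots> \<in> poly_vs.span (monom 1 ` {..<n})"
  proof (intro poly_vs.span_sum)
    fix i assume "i \<in> {..degree u}"
    show "smult (coeff u i) (monom 1 i) \<in> poly_vs.span (monom 1 ` {..<n})"
    proof (cases "u = 0")
      case False
      with assms \<open>i \<in> {..degree u}\<close> show ?thesis
        by (intro poly_vs.span_scale poly_vs.span_base) auto
    qed (simp add: poly_vs.span_zero)
  qed
  finally show ?thesis .
qed

text \<open>Eigenvectors for distinct eigenvalues are independent, and those chosen here lie in the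
  span of \<open>n\<close> monomials.\<close>

lemma card_eigenvalues_poly_le:
  fixes A :: "'a::field poly \<Rightarrow> 'a poly"
  assumes A: "Vector_Spaces.linear smult smult A"
    and L: "finite L" "\<And>c. c \<in> L \<Longrightarrow> \<exists>u. u \<noteq> 0 \<and> degree u < n \<and> A u = smult c u"
  shows "card L \<le> n"
proof -
  obtain v where v: "\<And>c. c \<in> L \<Longrightarrow> v c \<noteq> 0 \<and> degree (v c) < n \<and> A (v c) = smult c (v c)"
    using L(2) by metis
  have inj: "inj_on v L"
  proof (rule inj_onI)
    fix c c' assume "c \<in> L" "c' \<in> L" "v c = v c'"
    then have "smult c (v c) = smult c' (v c)"
      using v by metis
    then have "smult (c - c') (v c) = 0"
      by (simp only: smult_diff_left diff_self)
    then show "c = c'" using v[OF \<open>c \<in> L\<close>] by simp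
  qed
  have "poly_vs.independent (v ` L)"
  proof (rule poly_vs.independent_eigenvectors[OF _ _ _ A])
    \<comment> \<open>Eigenvalues are to be indexed by vectors, so \<open>l\<close> is the inverse
      of the choice \<open>v\<close>.\<close>
    show "inj_on (the_inv_into L v) (v ` L)"
      by (rule inj_on_the_inv_into[OF inj])
    show "A b = smult (the_inv_into L v b) b" if "b \<in> v ` L" for b
      using that v by (auto simp: the_inv_into_f_f[OF inj])
  qed (use L(1) v in auto)
  moreover have "v ` L \<subseteq> poly_vs.span (monom 1 ` {..<n})"
    using v by (auto intro: poly_in_span_monoms)
  ultimately have "card (v ` L) \<le> card ((\<lambda>i. monom (1::'a) i) ` {..<n})"
    using poly_vs.independent_span_bound[of "(\<lambda>i. monom (1::'a) i) ` {..<n}" "v ` L"] by simp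
  also have "\<dots> \<le> n"
    using card_image_le[of "{..<n}" "\<lambda>i. monom (1::'a) i"] by simp
  finally show ?thesis by (simp add: card_image[OF inj])
qed

section \<open>Counting the polynomials that skip a degree\<close>

text \<open>For \<open>k < degree f\<close> and \<open>degree f \<le> degree g\<close> this is the
  vanishing of the \<open>k\<close>-th subresultant coefficient, phrased as a nonzero kernel of a
  map linear in \<open>u\<close>.\<close>

definition skips_degree :: "'a::field poly \<Rightarrow> 'a poly \<Rightarrow> nat \<Rightarrow> bool" where
  "skips_degree g f k \<longleftrightarrow>
     (\<exists>u. u \<noteq> 0 \<and> degree u < degree g - k \<and> (\<forall>i\<ge>k. coeff (u * f mod g) i = 0))"

text \<open>\<open>poly_shift k\<close> turns the coefficients from \<open>k\<close> onwards into a
  polynomial again, so that eigenvalues make sense.\<close>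

lemma linear_shift_mult_mod:
  fixes f g :: "'a::field poly"
  shows "Vector_Spaces.linear smult smult (\<lambda>u. poly_shift k (u * f mod g))"
proof unfold_locales
  show "poly_shift k ((u + v) * f mod g) = poly_shift k (u * f mod g) + poly_shift k (v * f mod g)"
    for u v
    by (rule poly_eqI) (simp add: coeff_poly_shift distrib_right poly_mod_add_left)
  show "poly_shift k (smult c u * f mod g) = smult c (poly_shift k (u * f mod g))" for c u
    by (rule poly_eqI) (simp add: coeff_poly_shift mod_smult_left)
qed

lemma card_skips_degree_line_le:
  fixes f g :: "'a::{finite,field} poly"
  shows "card {t. skips_degree g (f + monom t k) k} \<le> degree g - k"
proof -
  let ?T = "{t. skips_degree g (f + monom t k) k}"
  have "card (uminus ` ?T) \<le> degree g - k"
  proof (rule card_eigenvalues_poly_le[OF linear_shift_mult_mod[of k f g]])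
    fix c assume "c \<in> uminus ` ?T"
    then obtain t u where c: "c = - t" and u: "u \<noteq> 0" "degree u < degree g - k"
      "\<And>i. i \<ge> k \<Longrightarrow> coeff (u * (f + monom t k) mod g) i = 0"
      by (auto simp: skips_degree_def)
    \<comment> \<open>As \<open>degree u < degree g - k\<close>, the added term
      \<open>u * monom t k\<close> is already reduced modulo \<open>g\<close>; after the shift it is
      \<open>smult t u\<close>.\<close>
    have "degree (u * monom t k) \<le> degree u + k"
      by (rule order_trans[OF degree_mult_le]) (simp add: degree_monom_le)
    then have "u * monom t k mod g = u * monom t k"
      using u(2) by (intro mod_poly_less) simp
    then have "u * (f + monom t k) mod g = u * f mod g + u * monom t k"
      by (simp add: distrib_left poly_mod_add_left)
    then have "coeff (u * f mod g) (i + k) + t * coeff u i = 0" for i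
      using u(3)[of "i + k"] by (simp add: mult.commute[of u] coeff_monom_mult)
    then have "poly_shift k (u * f mod g) = smult c u"
      by (intro poly_eqI) (simp add: coeff_poly_shift c eq_neg_iff_add_eq_0 add.commute)
    with u show "\<exists>u. u \<noteq> 0 \<and> degree u < degree g - k \<and> poly_shift k (u * f mod g) = smult c u"
      by blast
  qed simp
  then show ?thesis by (simp add: card_image)
qed

lemma monic_polys_add_monom:
  assumes "k < d" "f \<in> monic_polys d"
  shows "f + monom t k \<in> monic_polys d"
proof -
  have "degree (monom t k) < degree f"
    using assms degree_monom_le[of t k] by (auto simp: monic_polys_def)
  then have "degree (f + monom t k) = degree f"
    by (rule degree_add_eq_left)
  then show ?thesis using assms by (auto simp: monic_polys_def)
qed

text \<open>Double counting of the pairs \<open>(f, t)\<close> for which \<open>f + t x\<^sup>k\<close> skips degree \<open>k\<close>.\<close>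

lemma card_skips_degree_le:
  fixes g :: "'a::{finite,field} poly"
  assumes "k < d"
  shows "CARD('a) * card {f \<in> monic_polys d. skips_degree g f k}
           \<le> card (monic_polys d :: 'a poly set) * (degree g - k)"
proof -
  let ?M = "monic_polys d :: 'a poly set"
  have fin: "finite ?M" by (rule finite_monic_polys)
  \<comment> \<open>Translation by \<open>monom t k\<close> permutes \<open>?M\<close>, so the count
    does not depend on \<open>t\<close>.\<close>
  have "card {f \<in> ?M. skips_degree g (f + monom t k) k} = card {f \<in> ?M. skips_degree g f k}" for t
  proof (rule bij_betw_same_card)
    show "bij_betw (\<lambda>f. f + monom t k) {f \<in> ?M. skips_degree g (f + monom t k) k}
            {f \<in> ?M. skips_degree g f k}"
      using monic_polys_add_monom[OF assms, of _ t] monic_polys_add_monom[OF assms, of _ "-t"]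
      by (intro bij_betw_byWitness[where f' = "\<lambda>f. f + monom (-t) k"])
         (auto simp: add.assoc add_monom)
  qed
  then have "CARD('a) * card {f \<in> ?M. skips_degree g f k}
      = (\<Sum>t\<in>UNIV. card {f \<in> ?M. skips_degree g (f + monom t k) k})"
    by simp
  also have "\<dots> = (\<Sum>f\<in>?M. card {t. skips_degree g (f + monom t k) k})"
    using sum_multicount_gen[of UNIV ?M "\<lambda>t f. skips_degree g (f + monom t k) k"
      "\<lambda>f. card {t. skips_degree g (f + monom t k) k}"] fin by simp
  also have "\<dots> \<le> (\<Sum>f\<in>?M. degree g - k)"
    by (intro sum_mono card_skips_degree_line_le)
  finally show ?thesis by simp
qed

section \<open>Costs of the Euclidean algorithm\<close>

lemma t_poly_div_rec:
  "b \<noteq> 0 \<Longrightarrow> t_poly_div a b = 1 + t_poly_div b (a mod b)"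
  "t_poly_div a 0 = 0"
  by (simp_all add: t_poly_div_def euclid_divisions.simps[of a])

lemma t_field_div_rec:
  "b \<noteq> 0 \<Longrightarrow> t_field_div a b = degree a - degree b + 1 + t_field_div b (a mod b)"
  "t_field_div a 0 = 0"
  by (simp_all add: t_field_div_def div_cost_div_def euclid_divisions.simps[of a])

lemma t_submult_rec:
  "b \<noteq> 0 \<Longrightarrow> t_submult a b = degree b * (degree a - degree b + 1) + t_submult b (a mod b)"
  "t_submult a 0 = 0"
  by (simp_all add: t_submult_def div_cost_submult_def euclid_divisions.simps[of a])

text \<open>For dividend degree \<open>m\<close>, divisor degree \<open>n\<close> and a remainder of
  degree \<open>n - 1\<close>, later divisions cost \<open>n * (n - 1)\<close> in the extremal case;
  the total is again the product of the degrees.\<close>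

lemma submult_telescope:
  fixes m n :: nat
  assumes "n < m" "0 < n"
  shows "n * (m - n + 1) + n * (n - 1) = n * m"
proof -
  have "n * (m - n + 1) + n * (n - 1) = n * ((m - n + 1) + (n - 1))"
    by (simp only: distrib_left)
  then show ?thesis using assms by simp
qed

text \<open>Induction on the degree of the divisor: as the remainder has degree at most
  \<open>degree b - 1\<close>, the cost of the first division plus the bound for the rest stays
  within the bound.\<close>

lemma euclid_costs_le:
  fixes a b :: "'a::field poly"
  assumes "b \<noteq> 0" "degree b < degree a"
  shows "t_poly_div a b \<le> degree b + 1 \<and> t_field_div a b \<le> degree a + degree b + 1
    \<and> t_submult a b \<le> degree b * degree a"
  using assms
proof (induction "degree b" arbitrary: a b rule: less_induct)
  case less
  show ?case
  proof (cases "a mod b = 0")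
    case True
    have "degree b * (degree a - degree b + 1) \<le> degree b * degree a"
      using less.prems by (cases "degree b = 0") (simp, intro mult_left_mono, auto)
    with True less.prems show ?thesis
      by (simp add: t_poly_div_rec t_field_div_rec t_submult_rec)
  next
    case False
    have deg: "degree (a mod b) < degree b"
      using degree_mod_less[OF less.prems(1), of a] False by blast
    note IH = less.hyps[OF deg False deg]
    have "t_submult b (a mod b) \<le> degree b * (degree b - 1)"
    proof (rule order_trans[OF IH[THEN conjunct2, THEN conjunct2]])
      show "degree (a mod b) * degree b \<le> degree b * (degree b - 1)"
        using deg by (subst mult.commute) (intro mult_left_mono, auto)
    qed
    then have "t_submult a b \<le> degree b * degree a"
      using submult_telescope[OF less.prems(2)] deg less.prems(1)
      by (simp add: t_submult_rec)
    moreover have "t_field_div a b \<le> degree a + degree b + 1"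
      unfolding t_field_div_rec(1)[OF less.prems(1)] using IH deg less.prems by linarith
    ultimately show ?thesis
      using IH deg less.prems(1) by (simp add: t_poly_div_rec)
  qed
qed

text \<open>
  The polynomials \<open>s\<close> and \<open>t\<close> are the cofactors of \<open>f\<close> for two successive remainders \<open>a\<close> and \<open>b\<close>.
\<close>

lemma euclid_costs_eq_cofactors:
  fixes a b f g s t :: "'a::field poly"
  assumes "b \<noteq> 0" "degree b < degree a" "degree a \<le> degree g" "degree b \<le> d"
    and "\<And>k. k < d \<Longrightarrow> \<not> skips_degree g f k"
    and "s * f mod g = a mod g" "t * f mod g = b mod g"
    and "t \<noteq> 0" "degree t + degree a = degree g" "s = 0 \<or> degree s < degree t"
  shows "t_poly_div a b = degree b + 1 \<and> t_field_div a b = degree a + degree b + 1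
    \<and> t_submult a b = degree b * degree a"
  using assms
proof (induction "degree b" arbitrary: a b s t)
  case 0
  then have "a mod b = 0"
    using degree_mod_less[of b a] by auto
  with 0 show ?case
    by (simp add: t_poly_div_rec t_field_div_rec t_submult_rec)
next
  case (Suc n)
  \<comment> \<open>Extended Euclid: the cofactor of
    \<open>a mod b = a - (a div b) * b\<close>.\<close>
  define w where "w = s - (a div b) * t"
  have div: "a div b \<noteq> 0"
    using Suc.prems(1,2) by (auto simp: div_poly_eq_0_iff)
  have degr: "a mod b = 0 \<or> degree (a mod b) < degree b"
    using degree_mod_less[OF Suc.prems(1)] by blast
  \<comment> \<open>\<open>a div b * b\<close> differs from \<open>a\<close> by a term of smaller
    degree, which gives the degree of the quotient.\<close>
  then have "degree (- (a mod b)) < degree a"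
    using Suc.prems(2) by auto
  then have "degree (a + - (a mod b)) = degree a"
    by (rule degree_add_eq_left)
  then have "degree (a div b * b) = degree a"
    by (simp add: minus_mod_eq_div_mult)
  then have "degree (a div b) = degree a - degree b"
    using div Suc.prems(1) by (simp add: degree_mult_eq)
  with div have degqt: "degree ((a div b) * t) = degree a - degree b + degree t"
    using Suc.prems(8) by (simp add: degree_mult_eq)
  have "degree s < degree ((a div b) * t)"
    using degqt Suc.prems by auto
  then have degw: "degree w = degree a - degree b + degree t"
    using degree_add_eq_right[of s "- (a div b * t)"] degqt by (simp add: w_def)
  then have w0: "w \<noteq> 0"
    using Suc.prems(2) by auto
  have degw': "degree w + degree b = degree g"
    using degw Suc.prems(2,9) by simp
  have rg: "(a mod b) mod g = a mod b"
    using degr Suc.prems(2,3) by (auto intro: mod_poly_less)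
  have "w * f mod g = (s * f - (a div b) * (t * f)) mod g"
    by (simp add: w_def algebra_simps)
  also have "\<dots> = (a - (a div b) * b) mod g"
    by (intro mod_diff_cong mod_mult_cong refl Suc.prems)
  also have "\<dots> = a mod b mod g"
    by (simp add: minus_div_mult_eq_mod)
  finally have w: "w * f mod g = a mod b mod g" .
  have "degree b = Suc n" using Suc.hyps(2) by simp
  \<comment> \<open>Were the coefficients of \<open>a mod b\<close> from \<open>n\<close> on all
    zero, \<open>w\<close>, of degree \<open>degree g - n - 1\<close>, would witness that
    \<open>n\<close> is skipped.\<close>
  then have "degree w < degree g - n" "n < d"
    using degw' Suc.prems(4) by auto
  then obtain i where i: "i \<ge> n" "coeff (a mod b) i \<noteq> 0"
    using Suc.prems(5)[of n] w0 w rg by (auto simp: skips_degree_def)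
  then have r0: "a mod b \<noteq> 0" and "i \<le> degree (a mod b)"
    by (auto intro: le_degree)
  with i degr \<open>degree b = Suc n\<close> have r: "degree (a mod b) = n" by auto
  have "t_poly_div b (a mod b) = degree (a mod b) + 1
    \<and> t_field_div b (a mod b) = degree b + degree (a mod b) + 1
    \<and> t_submult b (a mod b) = degree (a mod b) * degree b"
  proof (rule Suc.hyps(1)[where s = t and t = w])
    show "t = 0 \<or> degree t < degree w"
      using degw Suc.prems(2) by auto
  qed (use r r0 w0 w degw' Suc.prems \<open>degree b = Suc n\<close> in auto)
  moreover have "degree b * (degree a - degree b + 1) + degree (a mod b) * degree b
      = degree b * degree a"
    using submult_telescope[OF Suc.prems(2)] \<open>degree b = Suc n\<close> r by (simp add: mult.commute)
  ultimately show ?case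
    using r \<open>degree b = Suc n\<close> Suc.prems(1,2)
    by (simp add: t_poly_div_rec t_field_div_rec t_submult_rec)
qed

lemma euclid_costs_eq:
  fixes f g :: "'a::field poly"
  assumes "f \<noteq> 0" "degree f < degree g"
    and "\<And>k. k < degree f \<Longrightarrow> \<not> skips_degree g f k"
  shows "t_poly_div g f = degree f + 1 \<and> t_field_div g f = degree g + degree f + 1
    \<and> t_submult g f = degree f * degree g"
  \<comment> \<open>The starting cofactors are 0 for \<open>g\<close> and 1 for \<open>f\<close>;
    the former is correct only modulo \<open>g\<close>, hence an invariant made of
    congruences.\<close>
  by (rule euclid_costs_eq_cofactors[where f = f and g = g and s = 0 and t = 1 and d = "degree f"])
     (use assms in auto)

section \<open>From the exceptional set to the expectations\<close>

text \<open>\<open>T\<close> falls short of \<open>m\<close> only on \<open>B\<close>, and by at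
  most \<open>m\<close> since it is nonnegative, so the mean loses at most the fraction
  \<open>p\<close> of \<open>m\<close>.\<close>

lemma expectation_near_max:
  fixes T :: "'b \<Rightarrow> nat" and m :: real
  assumes "finite S" "S \<noteq> {}" "m > 0"
    and le: "\<And>x. x \<in> S \<Longrightarrow> real (T x) \<le> m"
    and eq: "\<And>x. x \<in> S \<Longrightarrow> x \<notin> B \<Longrightarrow> real (T x) = m"
    and B: "real (card (S \<inter> B)) \<le> p * real (card S)"
  shows "\<bar>measure_pmf.expectation (pmf_of_set S) (\<lambda>x. real (T x)) / m - 1\<bar> \<le> p"
proof -
  have E: "measure_pmf.expectation (pmf_of_set S) (\<lambda>x. real (T x)) = (\<Sum>x\<in>S. real (T x)) / real (card S)"
    using assms by (simp add: integral_pmf_of_set)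
  have c: "real (card S) > 0" using assms by (simp add: card_gt_0_iff)
  have "(\<Sum>x\<in>S. m - real (T x)) \<le> (\<Sum>x\<in>S. if x \<in> B then m else 0)"
    using eq by (intro sum_mono) auto
  also have "\<dots> = m * real (card (S \<inter> B))"
    using assms by (simp add: sum.If_cases)
  also have "\<dots> \<le> m * (p * real (card S))"
    using B assms by (intro mult_left_mono) auto
  finally have lower: "m * real (card S) - (\<Sum>x\<in>S. real (T x)) \<le> m * (p * real (card S))"
    by (simp add: sum_subtractf mult.commute)
  have "(\<Sum>x\<in>S. real (T x)) \<le> m * real (card S)"
    using sum_mono[OF le, of S] by (simp add: mult.commute)
  then have "\<bar>(\<Sum>x\<in>S. real (T x)) / real (card S) / m - 1\<bar>
      = (m * real (card S) - (\<Sum>x\<in>S. real (T x))) / (m * real (card S))"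
    using c assms(3) by (simp add: field_simps abs_if)
  also have "\<dots> \<le> p"
    using lower c assms(3) by (simp add: field_simps)
  finally show ?thesis by (simp add: E)
qed

theorem theorem5p4:
  fixes g :: "'a::{finite,field} poly" and d e q :: nat
  assumes q: "q = CARD('a)"
    and d_pos: "0 < d" and e_pos: "0 < e" and e_gt_d: "d < e"
    and q_large: "real q > real d * (2 * real e - real d + 1) / 2"
    and g_monic: "lead_coeff g = 1" and g_degree: "degree g = e"
  shows "\<bar>measure_pmf.expectation (pmf_of_set (monic_polys d))
             (\<lambda>f. real (t_poly_div g f)) / (real d + 1) - 1\<bar>
           \<le> real d * real e / real q
       \<and> \<bar>measure_pmf.expectation (pmf_of_set (monic_polys d))
             (\<lambda>f. real (t_field_div g f)) / (real e + real d + 1) - 1\<bar>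
           \<le> real d * real e / real q
       \<and> \<bar>measure_pmf.expectation (pmf_of_set (monic_polys d))
             (\<lambda>f. real (t_submult g f)) / (real d * real e) - 1\<bar>
           \<le> real d * real e / real q"
proof -
  let ?M = "monic_polys d :: 'a poly set"
  define B where "B = {f. \<exists>k<d. skips_degree g f k}"
  have fin: "finite ?M" and ne: "?M \<noteq> {}"
    by (rule finite_monic_polys, rule monic_polys_nonempty)
  \<comment> \<open>Union bound over the \<open>d\<close> degrees that may be skipped.\<close>
  have "q * card (?M \<inter> B) \<le> q * card (\<Union>k<d. {f \<in> ?M. skips_degree g f k})"
    using fin by (intro mult_left_mono card_mono) (auto simp: B_def)
  also have "\<dots> \<le> q * (\<Sum>k<d. card {f \<in> ?M. skips_degree g f k})"
    by (intro mult_left_mono card_UN_le) auto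
  also have "\<dots> = (\<Sum>k<d. q * card {f \<in> ?M. skips_degree g f k})"
    by (rule sum_distrib_left)
  \<comment> \<open>The bounds \<open>e - k\<close> sum to \<open>d * (2 * e - d + 1) / 2\<close>;
    relaxing each to \<open>e\<close> gives \<open>d * e\<close>.\<close>
  also have "\<dots> \<le> (\<Sum>k<d. card ?M * e)"
  proof (rule sum_mono)
    fix k assume "k \<in> {..<d}"
    then have "q * card {f \<in> ?M. skips_degree g f k} \<le> card ?M * (e - k)"
      using card_skips_degree_le[of k d g] q g_degree by simp
    also have "\<dots> \<le> card ?M * e" by simp
    finally show "q * card {f \<in> ?M. skips_degree g f k} \<le> card ?M * e" .
  qed
  finally have "q * card (?M \<inter> B) \<le> d * e * card ?M" by (simp add: ac_simps)
  then have "real q * real (card (?M \<inter> B)) \<le> real d * real e * real (card ?M)"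
    by (metis of_nat_le_iff of_nat_mult)
  moreover have "q > 0" using q by simp
  ultimately have B: "real (card (?M \<inter> B)) \<le> real d * real e / real q * real (card ?M)"
    by (simp add: field_simps)
  have f: "f \<noteq> 0" "degree f = d" if "f \<in> ?M" for f
    using that by (auto simp: monic_polys_def)
  have le: "t_poly_div g f \<le> d + 1 \<and> t_field_div g f \<le> e + d + 1 \<and> t_submult g f \<le> d * e"
    if "f \<in> ?M" for f
    using euclid_costs_le[of f g] f[OF that] e_gt_d g_degree by simp
  have eq: "t_poly_div g f = d + 1 \<and> t_field_div g f = e + d + 1 \<and> t_submult g f = d * e"
    if "f \<in> ?M" "f \<notin> B" for f
    using euclid_costs_eq[of f g] f[OF that(1)] that(2) e_gt_d g_degree by (simp add: B_def)
  show ?thesis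
  \<comment> \<open>One exceptional set \<open>B\<close> serves all three costs.\<close>
  proof (intro conjI; rule expectation_near_max[OF fin ne _ _ _ B])
    fix f assume "f \<in> ?M"
    note le = le[OF this]
    show "real (t_poly_div g f) \<le> real d + 1" using le by linarith
    show "real (t_field_div g f) \<le> real e + real d + 1" using le by linarith
    show "real (t_submult g f) \<le> real d * real e" using le by (metis of_nat_le_iff of_nat_mult)
  qed (use eq d_pos e_pos in auto)
qed

end
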